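(* For $q,u\in\mathbb{C}$ with $|q|<1$ and $|u|<1$, $$\sum_{i,j\ge0}\frac{q^{2ij+j}u^i}{(q;q)_{2i}(q;q)_{j}}=\frac{1}{(1-u)(q;q)_\infty},\qquad \sum_{i,j\ge0}\frac{q^{2ij+2j}u^i}{(q;q)_{2i}(q;q)_{j}}=\frac{1-uq^2-q+uq}{(1-u)(1-uq^2)(q;q)_\infty},$$ $$\sum_{i,j\ge0}\frac{q^{2ij+2j}u^i}{(q;q)_{2i+1}(q;q)_{j}}=\frac{1}{(1-u)(q;q)_\infty},\qquad \sum_{i,j\ge0}\frac{q^{2ij+3j}u^i}{(q;q)_{2i+1}(q;q)_{j}}=\frac{1-q^2}{(1-u)(1-uq^2)(q;q)_\infty}.$$
   Context: For $|q|<1$: $(a;q)_\infty=\prod_{k\ge0}(1-aq^k)$ and, for integers $n\ge0$, $(a;q)_n=\prod_{k=0}^{n-1}(1-aq^k)$. *)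

theory Defs
  imports "HOL-Analysis.Analysis"
begin

definition qpoch :: "complex \<Rightarrow> complex \<Rightarrow> nat \<Rightarrow> complex" where
  "qpoch a q n = (\<Prod>k<n. 1 - a * q ^ k)"

text \<open>Intended for \<open>norm q < 1\<close>, where the product converges. \<open>prodinf\<close> also gives the
  correct value \<open>0\<close> when a factor vanishes.\<close>
definition qpoch_inf :: "complex \<Rightarrow> complex \<Rightarrow> complex" where
  "qpoch_inf a q = (\<Prod>k. 1 - a * q ^ k)"

end

theory Submission
  imports Defs
begin

text \<open>Everything reduces to Euler's identity \<open>\<Sum>j. z^j / (q;q)\<^sub>j = 1 / (z;q)\<^sub>\<infinity>\<close>: taking
  \<open>z = q^(m+1)\<close> and using \<open>(q;q)\<^sub>m (q^(m+1);q)\<^sub>\<infinity> = (q;q)\<^sub>\<infinity>\<close>, the inner sum over \<open>j\<close> becomes a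
  polynomial in \<open>q^i\<close> divided by \<open>(q;q)\<^sub>\<infinity>\<close>, and what is left is a combination of the geometric
  series in \<open>u\<close> and \<open>u q^2\<close>. Euler's identity itself follows from the functional equation
  \<open>F(qz) = (1 - z) F(z)\<close> of its left-hand side together with continuity at \<open>0\<close>.\<close>

section \<open>Finite and infinite q-Pochhammer products\<close>

lemma qpoch_0 [simp]: "qpoch a q 0 = 1"
  by (simp add: qpoch_def)

lemma qpoch_Suc: "qpoch a q (Suc n) = qpoch a q n * (1 - a * q ^ n)"
  by (simp add: qpoch_def)

lemma qpoch_add: "qpoch a q (m + n) = qpoch a q m * qpoch (a * q ^ m) q n"
  by (induction n) (simp_all add: qpoch_Suc power_add mult_ac)

lemma norm_mult_power_less_one:
  fixes a q :: complex
  assumes "norm q < 1" "norm a < 1"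
  shows "norm (a * q ^ k) < 1"
proof -
  have "norm (a * q ^ k) \<le> norm a * 1"
    unfolding norm_mult norm_power using assms
    by (intro mult_left_mono power_le_one) auto
  with assms show ?thesis by simp
qed

lemma qpoch_factor_nonzero:
  fixes a q :: complex
  assumes "norm q < 1" "norm a < 1"
  shows "1 - a * q ^ k \<noteq> 0"
  using norm_mult_power_less_one[OF assms, of k] by auto

lemma qpoch_nonzero: "norm q < 1 \<Longrightarrow> norm a < 1 \<Longrightarrow> qpoch a q n \<noteq> 0"
  by (simp add: qpoch_def qpoch_factor_nonzero del: right_minus_eq)

lemma convergent_prod_qpoch:
  fixes a q :: complex
  assumes "norm q < 1"
  shows "convergent_prod (\<lambda>k. 1 - a * q ^ k)"
proof -
  have "summable (\<lambda>k. norm (1 - a * q ^ k - 1))"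
    using assms by (auto simp: norm_mult norm_power intro!: summable_mult summable_geometric)
  thus ?thesis
    by (intro abs_convergent_prod_imp_convergent_prod summable_imp_abs_convergent_prod)
qed

lemma qpoch_tendsto_qpoch_inf:
  assumes "norm q < 1"
  shows "qpoch a q \<longlonglongrightarrow> qpoch_inf a q"
proof -
  have "(\<lambda>n. \<Prod>k\<le>n. 1 - a * q ^ k) \<longlonglongrightarrow> qpoch_inf a q"
    unfolding qpoch_inf_def by (intro convergent_prod_LIMSEQ convergent_prod_qpoch assms)
  \<comment> \<open>Partial products of \<open>prodinf\<close> run over \<open>k \<le> n\<close>,
    those of \<open>qpoch\<close> over \<open>k < n\<close>, hence the shift by one.\<close>
  hence "(\<lambda>n. qpoch a q (Suc n)) \<longlonglongrightarrow> qpoch_inf a q"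
    by (simp only: qpoch_def lessThan_Suc_atMost)
  thus ?thesis by (simp only: filterlim_sequentially_Suc)
qed

lemma qpoch_inf_nonzero:
  assumes "norm q < 1" "norm a < 1"
  shows "qpoch_inf a q \<noteq> 0"
  unfolding qpoch_inf_def
  using assms by (intro prodinf_nonzero convergent_prod_qpoch qpoch_factor_nonzero)

text \<open>Let \<open>n\<close> tend to infinity in \<open>qpoch_add\<close>.\<close>

lemma qpoch_mult_qpoch_inf:
  assumes "norm q < 1"
  shows "qpoch a q m * qpoch_inf (a * q ^ m) q = qpoch_inf a q"
proof (rule LIMSEQ_unique)
  show "(\<lambda>n. qpoch a q (m + n)) \<longlonglongrightarrow> qpoch a q m * qpoch_inf (a * q ^ m) q"
    unfolding qpoch_add by (intro tendsto_intros qpoch_tendsto_qpoch_inf assms)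
  show "(\<lambda>n. qpoch a q (m + n)) \<longlonglongrightarrow> qpoch_inf a q"
    using LIMSEQ_ignore_initial_segment[OF qpoch_tendsto_qpoch_inf[OF assms], of a m]
    by (simp add: add.commute)
qed

text \<open>The reciprocals converge because the infinite product is nonzero, so they are bounded.
  This uniform bound supplies the geometric majorants for the single and the double series.\<close>

lemma qpoch_inverse_bounded:
  assumes "norm q < 1" "norm a < 1"
  obtains B where "B > 0" "\<And>n. norm (inverse (qpoch a q n)) \<le> B"
proof -
  have "(\<lambda>n. inverse (qpoch a q n)) \<longlonglongrightarrow> inverse (qpoch_inf a q)"
    using assms by (intro tendsto_inverse qpoch_tendsto_qpoch_inf qpoch_inf_nonzero)
  hence "Bseq (\<lambda>n. inverse (qpoch a q n))"
    using convergentI convergent_imp_Bseq by blast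
  thus ?thesis using that unfolding Bseq_def by blast
qed

section \<open>Euler's identity\<close>

lemma summable_norm_euler:
  fixes q z :: complex
  assumes q: "norm q < 1" and z: "norm z < 1"
  shows "summable (\<lambda>j. norm (inverse (qpoch q q j) * z ^ j))"
proof -
  obtain B where B: "\<And>n. norm (inverse (qpoch q q n)) \<le> B"
    using qpoch_inverse_bounded[OF q q] by metis
  have "summable (\<lambda>j. B * norm z ^ j)"
    using z by (intro summable_mult summable_geometric) auto
  thus ?thesis
    by (rule summable_comparison_test'[where N = 0])
       (auto simp: norm_mult norm_power intro!: mult_right_mono B)
qed

lemma sums_euler:
  fixes q z :: complex
  assumes q: "norm q < 1" and z: "norm z < 1"
  shows "(\<lambda>j. inverse (qpoch q q j) * z ^ j) sums (1 / qpoch_inf z q)"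
proof -
  define c where "c = (\<lambda>j. inverse (qpoch q q j))"
  define F where "F = (\<lambda>z. \<Sum>j. c j * z ^ j)"
  have F: "(\<lambda>j. c j * w ^ j) sums F w" if "norm w < 1" for w
    unfolding F_def c_def
    by (rule summable_sums[OF summable_norm_cancel[OF summable_norm_euler[OF q that]]])
  \<comment> \<open>Coefficient form of the functional equation: passing from \<open>F w\<close> to
    \<open>F w - F (w * q)\<close> multiplies the coefficient of \<open>w ^ j\<close> by
    \<open>1 - q ^ j\<close>.\<close>
  have c_Suc: "c (Suc j) * (1 - q ^ Suc j) = c j" for j
    using qpoch_factor_nonzero[OF q q, of j] by (simp add: c_def qpoch_Suc)
  note small = norm_mult_power_less_one[OF q]
  have functional_eq: "F (w * q) = (1 - w) * F w" if w: "norm w < 1" for w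
  proof -
    have "(\<lambda>j. c j * w ^ j - c j * (w * q) ^ j) sums (F w - F (w * q))"
      using w small[OF w, of 1] by (intro sums_diff F) auto
    \<comment> \<open>The term at \<open>j = 0\<close> is \<open>c 0 - c 0 = 0\<close>, so dropping
      it leaves the sum unchanged.\<close>
    hence "(\<lambda>j. c (Suc j) * w ^ Suc j - c (Suc j) * (w * q) ^ Suc j) sums (F w - F (w * q))"
      by (subst sums_Suc_iff) simp
    also have "(\<lambda>j. c (Suc j) * w ^ Suc j - c (Suc j) * (w * q) ^ Suc j)
             = (\<lambda>j. w * (c j * w ^ j))"
    proof
      fix j
      have "c (Suc j) * w ^ Suc j - c (Suc j) * (w * q) ^ Suc j
          = w * ((c (Suc j) * (1 - q ^ Suc j)) * w ^ j)"
        by (simp add: algebra_simps power_mult_distrib)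
      thus "c (Suc j) * w ^ Suc j - c (Suc j) * (w * q) ^ Suc j = w * (c j * w ^ j)"
        by (simp only: c_Suc)
    qed
    finally have "w * F w = F w - F (w * q)"
      using sums_mult[OF F[OF w], of w] sums_unique2 by blast
    thus ?thesis by (simp add: algebra_simps)
  qed
  have iterate: "F (z * q ^ n) = qpoch z q n * F z" for n
  proof (induction n)
    case (Suc n)
    have "F (z * q ^ Suc n) = (1 - z * q ^ n) * F (z * q ^ n)"
      using functional_eq[OF small[OF z, of n]] by (simp add: mult_ac)
    with Suc show ?case by (simp add: qpoch_Suc)
  qed simp
  have F0: "F 0 = 1"
    unfolding F_def by (subst powser_zero) (simp add: c_def)
  have "(F \<longlongrightarrow> c 0) (at 0)"
    by (rule powser_limit_0[of 1]) (use F in auto)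
  hence "isCont F 0"
    using F0 by (simp add: isCont_def c_def)
  moreover have "(\<lambda>n. z * q ^ n) \<longlonglongrightarrow> z * 0"
    by (intro tendsto_mult tendsto_const LIMSEQ_power_zero q)
  \<comment> \<open>Continuity gives the limit \<open>F 0 = 1\<close>, while \<open>iterate\<close>
    gives the limit \<open>qpoch_inf z q * F z\<close>; comparing them determines
    \<open>F z\<close>.\<close>
  ultimately have "(\<lambda>n. F (z * q ^ n)) \<longlonglongrightarrow> F 0"
    by (simp add: isCont_tendsto_compose[of 0 F])
  moreover have "(\<lambda>n. F (z * q ^ n)) \<longlonglongrightarrow> qpoch_inf z q * F z"
    unfolding iterate by (intro tendsto_intros qpoch_tendsto_qpoch_inf q)
  ultimately have "qpoch_inf z q * F z = 1"
    using F0 LIMSEQ_unique by metis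
  hence "F z = 1 / qpoch_inf z q"
    using qpoch_inf_nonzero[OF q z] by (simp add: field_simps)
  with F[OF z] show ?thesis by (simp add: c_def)
qed

lemma has_sum_euler:
  fixes q z :: complex
  assumes "norm q < 1" "norm z < 1"
  shows "((\<lambda>j. inverse (qpoch q q j) * z ^ j) has_sum (1 / qpoch_inf z q)) UNIV"
  using assms by (intro norm_summable_imp_has_sum summable_norm_euler sums_euler)

section \<open>Reduction of the double sums to single sums\<close>

lemma has_sum_geometric:
  fixes x :: "'a :: {real_normed_field, banach}"
  assumes "norm x < 1"
  shows "((\<lambda>i. x ^ i) has_sum (1 / (1 - x))) UNIV"
  using assms
  by (intro norm_summable_imp_has_sum geometric_sums) (auto simp: norm_power intro: summable_geometric)

text \<open>Common form of all four identities: Euler's identity at \<open>z = q ^ Suc (m i)\<close>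
  evaluates the sum over \<open>j\<close>, and the assumption on \<open>S\<close> is the sum over
  \<open>i\<close> that remains.\<close>

lemma has_sum_qpoch_double:
  fixes q u :: complex and m n :: "nat \<Rightarrow> nat"
  assumes q: "norm q < 1" and u: "norm u < 1"
    and S: "((\<lambda>i. u ^ i * (qpoch q q (m i) / qpoch q q (n i))) has_sum S) UNIV"
  shows "((\<lambda>(i, j). q ^ (Suc (m i) * j) * u ^ i / (qpoch q q (n i) * qpoch q q j))
            has_sum (S / qpoch_inf q q)) UNIV"
proof -
  define f where
    "f = (\<lambda>(i, j). q ^ (Suc (m i) * j) * u ^ i / (qpoch q q (n i) * qpoch q q j))"
  have row: "((\<lambda>j. f (i, j)) has_sum
      (u ^ i * (qpoch q q (m i) / qpoch q q (n i)) / qpoch_inf q q)) UNIV" for i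
  proof -
    have "norm (q ^ Suc (m i)) < 1"
      using norm_mult_power_less_one[OF q q, of "m i"] by simp
    from has_sum_cmult_right[OF has_sum_euler[OF q this], of "u ^ i / qpoch q q (n i)"]
    have "((\<lambda>j. f (i, j)) has_sum
        (u ^ i / qpoch q q (n i) * (1 / qpoch_inf (q ^ Suc (m i)) q))) UNIV"
      unfolding f_def power_mult by (simp add: divide_simps mult_ac)
    also have "1 / qpoch_inf (q ^ Suc (m i)) q = qpoch q q (m i) / qpoch_inf q q"
      using qpoch_nonzero[OF q q] by (simp flip: qpoch_mult_qpoch_inf[OF q, of q "m i"])
    finally show ?thesis by simp
  qed
  have "f summable_on UNIV"
  proof -
    obtain B where B: "B > 0" "\<And>k. norm (inverse (qpoch q q k)) \<le> B"
      using qpoch_inverse_bounded[OF q q] by metis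
    \<comment> \<open>Since \<open>Suc (m i) * j\<close> is at least \<open>j\<close>, the mixed
      power of \<open>q\<close> is dominated by \<open>norm q ^ j\<close>. This decouples the
      indices and leaves a product of two geometric series.\<close>
    define g where "g = (\<lambda>(i, j). (B * B * norm u ^ i) * norm q ^ j)"
    have "g summable_on (SIGMA i:UNIV. UNIV)"
    proof (rule summable_on_SigmaI)
      show "((\<lambda>j. g (i, j)) has_sum (B * B * norm u ^ i) * (1 / (1 - norm q))) UNIV" for i
        unfolding g_def prod.case using q by (intro has_sum_cmult_right has_sum_geometric) auto
      show "(\<lambda>i. (B * B * norm u ^ i) * (1 / (1 - norm q))) summable_on UNIV"
        using has_sum_geometric[of "norm u"] u
        by (intro summable_on_cmult_left summable_on_cmult_right) (auto simp: summable_on_def)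
    qed (auto simp: g_def B(1) less_imp_le)
    hence "g summable_on UNIV" by simp
    moreover have "norm (f x) \<le> g x" for x
    proof (cases x)
      case (Pair i j)
      have "norm (f x) = norm q ^ (Suc (m i) * j) * norm u ^ i *
          (norm (inverse (qpoch q q (n i))) * norm (inverse (qpoch q q j)))"
        by (simp add: Pair f_def norm_mult norm_divide norm_power norm_inverse divide_simps)
      also have "\<dots> \<le> norm q ^ j * norm u ^ i * (B * B)"
        using q B by (intro order_refl mult_mono power_decreasing) auto
      finally show ?thesis by (simp add: Pair g_def mult_ac)
    qed
    ultimately show ?thesis
      by (rule abs_summable_summable[OF Infinite_Sum.abs_summable_on_comparison_test'])
  qed
  hence "(f has_sum (S / qpoch_inf q q)) (SIGMA i:UNIV. UNIV)"
  proof (intro has_sum_SigmaI[OF row])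
    show "((\<lambda>i. u ^ i * (qpoch q q (m i) / qpoch q q (n i)) / qpoch_inf q q)
        has_sum S / qpoch_inf q q) UNIV"
      using has_sum_cmult_left[OF S, of "inverse (qpoch_inf q q)"] by (simp add: divide_inverse)
  qed simp
  thus ?thesis by (simp add: f_def)
qed

text \<open>The terms split into geometric series of ratios \<open>u\<close> and
  \<open>u * q\<^sup>2\<close>. It is applied with \<open>a = q\<close> and
  \<open>a = q\<^sup>2\<close>.\<close>

lemma has_sum_linear_combination_geometric:
  fixes q u a :: complex
  assumes q: "norm q < 1" and u: "norm u < 1"
  shows "((\<lambda>i. u ^ i * (1 - a * q ^ (2 * i)))
            has_sum (1 / (1 - u) - a / (1 - u * q\<^sup>2))) UNIV"
proof -
  have "norm (u * q\<^sup>2) < 1"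
    by (rule norm_mult_power_less_one[OF q u])
  from has_sum_add[OF has_sum_geometric[OF u] has_sum_cmult_right[OF has_sum_geometric[OF this], of "- a"]]
  show ?thesis
    by (simp add: algebra_simps power_mult_distrib flip: power_mult)
qed

theorem theorem3p6:
  fixes q u :: complex
  assumes "norm q < 1" and "norm u < 1"
  shows "((\<lambda>(i::nat, j::nat). q ^ (2*i*j + j) * u ^ i / (qpoch q q (2*i) * qpoch q q j))
            has_sum (1 / ((1 - u) * qpoch_inf q q))) UNIV
       \<and> ((\<lambda>(i::nat, j::nat). q ^ (2*i*j + 2*j) * u ^ i / (qpoch q q (2*i) * qpoch q q j))
            has_sum ((1 - u * q\<^sup>2 - q + u * q) / ((1 - u) * (1 - u * q\<^sup>2) * qpoch_inf q q))) UNIV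
       \<and> ((\<lambda>(i::nat, j::nat). q ^ (2*i*j + 2*j) * u ^ i / (qpoch q q (2*i + 1) * qpoch q q j))
            has_sum (1 / ((1 - u) * qpoch_inf q q))) UNIV
       \<and> ((\<lambda>(i::nat, j::nat). q ^ (2*i*j + 3*j) * u ^ i / (qpoch q q (2*i + 1) * qpoch q q j))
            has_sum ((1 - q\<^sup>2) / ((1 - u) * (1 - u * q\<^sup>2) * qpoch_inf q q))) UNIV"
proof -
  define P where "P = qpoch q q"
  note q = assms(1) and u = assms(2)
  note double = has_sum_qpoch_double[OF q u]
  have P_nz: "P k \<noteq> 0" for k
    unfolding P_def by (rule qpoch_nonzero[OF q q])
  have P_Suc: "P (Suc k) / P k = 1 - q * q ^ k" for k
    using P_nz[of k] by (simp add: P_def qpoch_Suc)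
  have u_nz: "1 - u \<noteq> 0"
    using u by auto
  have uq_nz: "1 - u * q\<^sup>2 \<noteq> 0"
    by (rule qpoch_factor_nonzero[OF q u])

  \<comment> \<open>The first and third identities have \<open>m = n\<close>, so the quotient is
    1.\<close>
  have geom: "((\<lambda>i. u ^ i * (P (k i) / P (k i))) has_sum (1 / (1 - u))) UNIV" for k
    using has_sum_geometric[OF u] P_nz by simp
  \<comment> \<open>In the second and fourth identities \<open>m i = Suc (n i)\<close>, so the
    quotient is a single factor: \<open>1 - q ^ (2 * i + 1)\<close> here,
    \<open>1 - q ^ (2 * i + 2)\<close> in \<open>shifted'\<close>.\<close>
  have shifted: "((\<lambda>i. u ^ i * (P (Suc (2 * i)) / P (2 * i)))
      has_sum (1 / (1 - u) - q / (1 - u * q\<^sup>2))) UNIV"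
    unfolding P_Suc by (rule has_sum_linear_combination_geometric[OF q u])
  have shifted': "((\<lambda>i. u ^ i * (P (Suc (2 * i + 1)) / P (2 * i + 1)))
      has_sum (1 / (1 - u) - q\<^sup>2 / (1 - u * q\<^sup>2))) UNIV"
    unfolding P_Suc using has_sum_linear_combination_geometric[OF q u, of "q\<^sup>2"]
    by (simp add: power2_eq_square mult.assoc)

  have "1 / (1 - u) - q / (1 - u * q\<^sup>2) = (1 - u * q\<^sup>2 - q + u * q) / ((1 - u) * (1 - u * q\<^sup>2))"
    using u_nz uq_nz by (simp add: diff_frac_eq) (simp add: algebra_simps)
  moreover have "1 / (1 - u) - q\<^sup>2 / (1 - u * q\<^sup>2) = (1 - q\<^sup>2) / ((1 - u) * (1 - u * q\<^sup>2))"
    using u_nz uq_nz by (simp add: diff_frac_eq) (simp add: algebra_simps)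
  \<comment> \<open>These match the exponents \<open>Suc (m i) * j\<close> with those of the four
    identities, in order.\<close>
  moreover have "Suc (2 * i) * j = 2 * i * j + j" "Suc (Suc (2 * i)) * j = 2 * i * j + 2 * j"
    "Suc (2 * i + 1) * j = 2 * i * j + 2 * j"
    "Suc (Suc (2 * i + 1)) * j = 2 * i * j + 3 * j" for i j :: nat
    by (simp_all add: algebra_simps)
  ultimately show ?thesis
    using double[OF geom[of "\<lambda>i. 2 * i", unfolded P_def]] double[OF shifted[unfolded P_def]]
      double[OF geom[of "\<lambda>i. 2 * i + 1", unfolded P_def]] double[OF shifted'[unfolded P_def]]
    by (simp only: divide_divide_eq_left)
qed

end
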